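(* Let $R$ be a prime ring with $\mathrm{char}(R)\neq 2$ and let $(D_1,d_1)$ and $(D_2,d_2)$ be generalized derivations on $R$. Then $(D_1^2+D_1D_2,\ d_1^2+d_1d_2)$ is a generalized derivation on $R$ if and only if one of the following statements holds: (i) $d_1\neq 0$, $d_1=-d_2$ and $D_1=-D_2$; (ii) $d_1=0$, $d_2\neq 0$ and $D_1=0$; (iii) $D_1$ and $D_2$ are left centralizers, i.e. $D_i(xy)=D_i(x)y$ for all $x,y\in R$ and $i=1,2$.
   Context: Rings are associative and not assumed to have an identity. A ring $R$ is prime if for $x,y\in R$, $xRy=\{0\}$ implies $x=0$ or $y=0$. A derivation on $R$ is an additive mapping $d:R\to R$ with $d(xy)=d(x)y+xd(y)$ for all $x,y\in R$. A generalized derivation $(D,d)$ on $R$ is an additive mapping $D:R\to R$ together with a derivation $d$ on $R$ (the associated derivation) such that $D(xy)=D(x)y+xd(y)$ for all $x,y\in R$; in particular, saying that a pair $(D,d)$ is a generalized derivation includes that $d$ is a derivation. A left centralizer is an additive mapping $T:R\to R$ with $T(xy)=T(x)y$ for all $x,y\in R$. Products and powers of maps denote composition. *)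

theory Defs
  imports Complex_Main
begin

text \<open>
  The type class \<^class>\<open>ring\<close> is the class of associative rings, with neither commutativity nor
  an identity assumed. The type argument plays the role of the ring \<open>R\<close>.
\<close>

definition prime_ring :: "'a::ring itself \<Rightarrow> bool" where
  "prime_ring _ \<longleftrightarrow>
     (\<forall>x y :: 'a. {x * r * y | r. True} = {0} \<longrightarrow> x = 0 \<or> y = 0)"

text \<open>
  \<open>CHAR('a)\<close> needs an identity. Here the characteristic is the least \<open>n > 0\<close> with \<open>n x = 0\<close> for
  all \<open>x\<close>, and \<open>0\<close> if there is none; the multiple \<open>n x\<close> is written as an \<open>n\<close>-fold sum.
\<close>

definition ring_char :: "'a::ring itself \<Rightarrow> nat" where
  "ring_char _ =
     (if \<exists>n::nat. n > 0 \<and> (\<forall>x::'a. (\<Sum>i<n. x) = 0)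
      then LEAST n::nat. n > 0 \<and> (\<forall>x::'a. (\<Sum>i<n. x) = 0)
      else 0)"

definition derivation :: "('a::ring \<Rightarrow> 'a) \<Rightarrow> bool" where
  "derivation d \<longleftrightarrow> additive d \<and> (\<forall>x y. d (x * y) = d x * y + x * d y)"

definition generalized_derivation :: "('a::ring \<Rightarrow> 'a) \<Rightarrow> ('a \<Rightarrow> 'a) \<Rightarrow> bool" where
  "generalized_derivation D d \<longleftrightarrow>
     additive D \<and> derivation d \<and> (\<forall>x y. D (x * y) = D x * y + x * d y)"

definition left_centralizer :: "('a::ring \<Rightarrow> 'a) \<Rightarrow> bool" where
  "left_centralizer T \<longleftrightarrow> additive T \<and> (\<forall>x y. T (x * y) = T x * y)"

end

theory Submission
  imports Defs
begin

text \<open>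
  With \<open>E = D\<^sub>1 + D\<^sub>2\<close> and \<open>e = d\<^sub>1 + d\<^sub>2\<close>, the pair in question is the composition
  \<open>(D\<^sub>1 E, d\<^sub>1 e)\<close>. Expanding \<open>D\<^sub>1 E (x y)\<close>, it is a generalized derivation iff
  \<open>E x d\<^sub>1 y + D\<^sub>1 x e y = 0\<close> and \<open>e x d\<^sub>1 y + d\<^sub>1 x e y = 0\<close> for all \<open>x\<close>, \<open>y\<close>. By
  Posner's theorem the second identity forces \<open>d\<^sub>1 = 0\<close> or \<open>e = 0\<close>, and primeness applied to
  what is left of the first identity yields the three cases.
\<close>

lemma prime_ringD:
  fixes a b :: "'a::ring"
  assumes "prime_ring TYPE('a)" and "\<And>r. a * r * b = 0"
  shows "a = 0 \<or> b = 0"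
proof -
  have "{a * r * b | r. True} = {0}"
    using assms(2) by auto
  then show ?thesis
    using assms(1) unfolding prime_ring_def by blast
qed

text \<open>A single nonzero \<open>x\<close> with \<open>x + x = 0\<close> would spread 2-torsion
  to the whole ring: the factor 2 moves from \<open>y + y\<close> to \<open>x\<close>, and primeness
  cancels \<open>x\<close>. As 1 does not kill \<open>x\<close>, the characteristic would be
  2.\<close>

lemma prime_ring_two_torsion_free:
  fixes x :: "'a::ring"
  assumes "prime_ring TYPE('a)" and "ring_char TYPE('a) \<noteq> 2" and "x + x = 0"
  shows "x = 0"
proof (rule ccontr)
  assume "x \<noteq> 0"
  have dbl: "y + y = 0" for y :: 'a
  proof -
    have "x * r * (y + y) = (x + x) * r * y" for r
      by (simp add: algebra_simps)
    then have "x = 0 \<or> y + y = 0"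
      by (intro prime_ringD[OF assms(1)]) (simp add: assms(3))
    then show ?thesis using \<open>x \<noteq> 0\<close> by simp
  qed
  let ?P = "\<lambda>n::nat. n > 0 \<and> (\<forall>x::'a. (\<Sum>i<n. x) = 0)"
  have two: "?P 2"
    using dbl by (simp add: numeral_2_eq_2)
  have "(LEAST n. ?P n) = 2"
  proof (rule Least_equality[of ?P, OF two])
    fix n assume n: "?P n"
    have "n \<noteq> 1"
      using n \<open>x \<noteq> 0\<close> by auto
    then show "2 \<le> n" using n by linarith
  qed
  then have "ring_char TYPE('a) = 2"
    using exI[of ?P, OF two] unfolding ring_char_def by presburger
  then show False using assms(2) by simp
qed

lemma derivation_add:
  assumes "derivation d" and "derivation d'"
  shows "derivation (\<lambda>x. d x + d' x)"
  using assms unfolding derivation_def additive_def by (simp add: algebra_simps)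

lemma generalized_derivation_add:
  assumes "generalized_derivation D d" and "generalized_derivation D' d'"
  shows "generalized_derivation (\<lambda>x. D x + D' x) (\<lambda>x. d x + d' x)"
  using assms derivation_add[of d d']
  unfolding generalized_derivation_def additive_def by (simp add: algebra_simps)

lemma derivation_imp_generalized_derivation:
  "derivation d \<Longrightarrow> generalized_derivation d d"
  unfolding generalized_derivation_def derivation_def by simp

text \<open>The outer two of the four terms make up the product rule for the composition, so that
  rule amounts to the cancellation of the middle two.\<close>

lemma generalized_derivation_comp_mult:
  assumes "generalized_derivation D d" and "generalized_derivation E e"
  shows "D (E (x * y)) = D (E x) * y + E x * d y + (D x * e y + x * d (e y))"
  using assms unfolding generalized_derivation_def additive_def by simp

lemma derivation_comp_iff:
  assumes "derivation d" and "derivation e"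
  shows "derivation (\<lambda>x. d (e x)) \<longleftrightarrow> (\<forall>x y. e x * d y + d x * e y = 0)"
proof -
  have "additive (\<lambda>x. d (e x))"
    using assms unfolding derivation_def additive_def by simp
  moreover have "d (e (x * y)) = d (e x) * y + e x * d y + (d x * e y + x * d (e y))" for x y
    using assms by (intro generalized_derivation_comp_mult derivation_imp_generalized_derivation)
  ultimately show ?thesis
    unfolding derivation_def by (simp add: add.assoc[symmetric])
qed

lemma generalized_derivation_comp_iff:
  assumes "generalized_derivation D d" and "generalized_derivation E e"
  shows "generalized_derivation (\<lambda>x. D (E x)) (\<lambda>x. d (e x)) \<longleftrightarrow>
    (\<forall>x y. E x * d y + D x * e y = 0) \<and> (\<forall>x y. e x * d y + d x * e y = 0)"
proof -
  have "additive (\<lambda>x. D (E x))"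
    using assms unfolding generalized_derivation_def additive_def by simp
  moreover have "derivation (\<lambda>x. d (e x)) \<longleftrightarrow> (\<forall>x y. e x * d y + d x * e y = 0)"
    using assms by (intro derivation_comp_iff) (auto simp: generalized_derivation_def)
  ultimately show ?thesis
    unfolding generalized_derivation_def[of "\<lambda>x. D (E x)"]
      generalized_derivation_comp_mult[OF assms]
    by (simp add: add.assoc[symmetric]) (auto simp add: add.assoc)
qed

text \<open>By \<open>derivation_comp_iff\<close>, \<open>zero\<close> says that the composition of
  \<open>d\<close> and \<open>e\<close> is a derivation. The dichotomy is first proved at each point
  \<open>x\<close>; a fixed \<open>z\<close> with \<open>e z\<close> nonzero then settles the points
  where \<open>e x = 0\<close>.\<close>

lemma posner:
  fixes d e :: "'a::ring \<Rightarrow> 'a"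
  assumes prime: "prime_ring TYPE('a)" and char: "ring_char TYPE('a) \<noteq> 2"
    and "derivation d" and "derivation e"
    and zero: "\<And>x y. e x * d y + d x * e y = 0"
  shows "d = (\<lambda>x. 0) \<or> e = (\<lambda>x. 0)"
proof (rule disjCI)
  assume "e \<noteq> (\<lambda>x. 0)"
  then obtain z where z: "e z \<noteq> 0" by auto
  \<comment> \<open>Replacing \<open>y\<close> by \<open>y * w\<close> in \<open>zero\<close>
    inserts an arbitrary middle factor, the form that primeness needs.\<close>
  have mid: "d x * y * e w = - (e x * y * d w)" for x y w
  proof -
    have "e x * d (y * w) + d x * e (y * w)
        = (e x * d y + d x * e y) * w + (e x * y * d w + d x * y * e w)"
      using assms(3,4) unfolding derivation_def by (simp add: algebra_simps)
    then have "e x * y * d w + d x * y * e w = 0"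
      by (simp add: zero)
    then show ?thesis by (simp add: eq_neg_iff_add_eq_0 add.commute)
  qed
  show "d = (\<lambda>x. 0)"
  proof
    fix x
    have "d x = 0 \<or> e x = 0"
    proof (rule ccontr)
      assume "\<not> (d x = 0 \<or> e x = 0)"
      then have nz: "d x \<noteq> 0" "e x \<noteq> 0" by auto
      have "e x * s * e x = 0 \<or> d x = 0" for s
      proof -
        \<comment> \<open>Moving \<open>d x\<close> across one or two factors \<open>e x\<close> gives opposite signs.\<close>
        have "d x * r * (e x * s * e x) = 0" for r
        proof (rule prime_ring_two_torsion_free[OF prime char])
          have "d x * r * (e x * s * e x) = d x * (r * e x * s) * e x"
            by (simp add: mult.assoc)
          also have "\<dots> = - (e x * r * (e x * s * d x))"
            by (subst mid) (simp add: mult.assoc)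
          also have "\<dots> = e x * r * (d x * s * e x)"
            by (simp add: mid)
          also have "\<dots> = (e x * r * d x) * (s * e x)"
            by (simp add: mult.assoc)
          also have "e x * r * d x = - (d x * r * e x)"
            by (simp add: mid)
          finally show "d x * r * (e x * s * e x) + d x * r * (e x * s * e x) = 0"
            by (simp add: mult.assoc eq_neg_iff_add_eq_0)
        qed
        then show ?thesis using prime_ringD[OF prime] by blast
      qed
      then show False using prime_ringD[OF prime, of "e x" "e x"] nz by blast
    qed
    moreover have "d x = 0" if "e x = 0"
      using prime_ringD[OF prime, of "d x" "e z"] mid[of x _ z] that z by simp
    ultimately show "d x = 0" by blast
  qed
qed

text \<open>Expanding \<open>a * d (y * z)\<close> leaves \<open>a * y * d z = 0\<close> for all
  \<open>y\<close>; primeness applies at a \<open>z\<close> with \<open>d z\<close> nonzero.\<close>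

lemma prime_ring_mult_derivation_eq_zero:
  fixes d :: "'a::ring \<Rightarrow> 'a"
  assumes "prime_ring TYPE('a)" and "derivation d" and "d \<noteq> (\<lambda>x. 0)"
    and "\<And>y. a * d y = 0"
  shows "a = 0"
proof -
  obtain z where z: "d z \<noteq> 0" using assms(3) by auto
  have "a * y * d z = a * d (y * z) - a * d y * z" for y
    using assms(2) unfolding derivation_def by (simp add: algebra_simps)
  then show ?thesis
    using prime_ringD[OF assms(1), of a "d z"] assms(4) z by simp
qed

text \<open>Comparing the two product rules for \<open>D\<close> gives \<open>x * d y = 0\<close>
  for all \<open>x\<close> and \<open>y\<close>; the choice \<open>x = d y * r\<close> brings in
  primeness.\<close>

lemma generalized_derivation_left_centralizer_iff:
  fixes D d :: "'a::ring \<Rightarrow> 'a"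
  assumes "prime_ring TYPE('a)" and "generalized_derivation D d"
  shows "left_centralizer D \<longleftrightarrow> d = (\<lambda>x. 0)"
proof
  assume "left_centralizer D"
  then have xd: "x * d y = 0" for x y
    using assms(2) unfolding generalized_derivation_def left_centralizer_def
    by (metis add_cancel_left_right)
  show "d = (\<lambda>x. 0)"
  proof
    fix y show "d y = 0"
      using prime_ringD[OF assms(1), of "d y" "d y"] xd by blast
  qed
next
  assume "d = (\<lambda>x. 0)"
  then show "left_centralizer D"
    using assms(2) unfolding generalized_derivation_def left_centralizer_def by simp
qed

theorem theorem3p1:
  fixes D1 D2 d1 d2 :: "'a::ring \<Rightarrow> 'a"
  assumes "prime_ring TYPE('a)"
    and "ring_char TYPE('a) \<noteq> 2"
    and "generalized_derivation D1 d1"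
    and "generalized_derivation D2 d2"
  shows "generalized_derivation
           (\<lambda>x. (D1 ^^ 2) x + (D1 \<circ> D2) x) (\<lambda>x. (d1 ^^ 2) x + (d1 \<circ> d2) x) \<longleftrightarrow>
         (d1 \<noteq> (\<lambda>x. 0) \<and> d1 = (\<lambda>x. - d2 x) \<and> D1 = (\<lambda>x. - D2 x)) \<or>
         (d1 = (\<lambda>x. 0) \<and> d2 \<noteq> (\<lambda>x. 0) \<and> D1 = (\<lambda>x. 0)) \<or>
         (left_centralizer D1 \<and> left_centralizer D2)"
proof -
  note prime = assms(1)
  define E where "E = (\<lambda>x. D1 x + D2 x)"
  define e where "e = (\<lambda>x. d1 x + d2 x)"
  have E: "generalized_derivation E e"
    unfolding E_def e_def by (rule generalized_derivation_add[OF assms(3,4)])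
  have d1: "derivation d1" and e: "derivation e"
    using assms(3) E unfolding generalized_derivation_def by auto
  have "additive D1" "additive d1"
    using assms(3) unfolding generalized_derivation_def derivation_def by auto
  \<comment> \<open>Additivity lets \<open>D1\<close> and \<open>d1\<close> be factored out on the
    left.\<close>
  then have comp: "(\<lambda>x. (D1 ^^ 2) x + (D1 \<circ> D2) x) = (\<lambda>x. D1 (E x))"
    "(\<lambda>x. (d1 ^^ 2) x + (d1 \<circ> d2) x) = (\<lambda>x. d1 (e x))"
    by (auto simp: E_def e_def additive_def numeral_2_eq_2)
  have lc: "left_centralizer D1 \<longleftrightarrow> d1 = (\<lambda>x. 0)" "left_centralizer D2 \<longleftrightarrow> d2 = (\<lambda>x. 0)"
    using generalized_derivation_left_centralizer_iff[OF prime] assms(3,4) by blast+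
  have E0: "D1 = (\<lambda>x. - D2 x) \<longleftrightarrow> (\<forall>x. E x = 0)" and e0: "d1 = (\<lambda>x. - d2 x) \<longleftrightarrow> (\<forall>x. e x = 0)"
    by (auto simp: E_def e_def fun_eq_iff eq_neg_iff_add_eq_0)
  have e_eq: "e = d2" if "d1 = (\<lambda>x. 0)"
    using that by (simp add: e_def)
  show ?thesis
    unfolding comp generalized_derivation_comp_iff[OF assms(3) E] lc E0 e0
  proof
    assume A: "(\<forall>x y. E x * d1 y + D1 x * e y = 0) \<and> (\<forall>x y. e x * d1 y + d1 x * e y = 0)"
    show "(d1 \<noteq> (\<lambda>x. 0) \<and> (\<forall>x. e x = 0) \<and> (\<forall>x. E x = 0)) \<or>
      (d1 = (\<lambda>x. 0) \<and> d2 \<noteq> (\<lambda>x. 0) \<and> D1 = (\<lambda>x. 0)) \<or> (d1 = (\<lambda>x. 0) \<and> d2 = (\<lambda>x. 0))"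
    proof (cases "d1 = (\<lambda>x. 0)")
      case True
      \<comment> \<open>Here \<open>e = d2\<close>, and the first identity reduces to
        \<open>D1 x * d2 y = 0\<close>.\<close>
      have "D1 x = 0" if "d2 \<noteq> (\<lambda>x. 0)" for x
        using prime_ring_mult_derivation_eq_zero[OF prime e, of "D1 x"] A True e_eq that
        by simp
      then show ?thesis using True by auto
    next
      case False
      then have "e = (\<lambda>x. 0)"
        using posner[OF prime assms(2) d1 e] A by blast
      \<comment> \<open>With \<open>e = 0\<close> the first identity reduces to
        \<open>E x * d1 y = 0\<close>.\<close>
      moreover from this have "E x = 0" for x
        using prime_ring_mult_derivation_eq_zero[OF prime d1 False, of "E x"] A by simp
      ultimately show ?thesis using False by simp
    qed
  \<comment> \<open>Converse: in each of the three cases every product in both identities has a zero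
    factor.\<close>
  qed (use e_eq in auto)
qed

end
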